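(* Let $(\mathcal{A},[\cdot,\cdot]_{\mathcal{A}},a_{\mathcal{A}};\rho)$ be a LieRep pair, with $\rho$ a representation on $E$, and let $T:E\to\mathcal{A}$ be a relative Rota--Baxter operator. Then for a bundle map $T':E\to\mathcal{A}$, $T+T'$ is still a relative Rota--Baxter operator on $(\mathcal{A},[\cdot,\cdot]_{\mathcal{A}},a_{\mathcal{A}};\rho)$ if and only if $T'$ is a Maurer--Cartan element of the differential graded Lie algebra $(\mathcal{C}^*(E,\mathcal{A}),[\![\cdot,\cdot]\!],\tilde{\mathrm{d}}_T)$, where $\tilde{\mathrm{d}}_T=[\![T,\cdot]\!]$.
   Context: Vector bundles are smooth real vector bundles over a smooth manifold $M$, and bundle maps cover the identity of $M$. A Lie algebroid $(\mathcal{A},[\cdot,\cdot]_{\mathcal{A}},a_{\mathcal{A}})$ is a vector bundle $\mathcal{A}\to M$ with a Lie bracket on $\Gamma(\mathcal{A})$ and a bundle map $a_{\mathcal{A}}:\mathcal{A}\to TM$ with $[x,fy]_{\mathcal{A}}=f[x,y]_{\mathcal{A}}+a_{\mathcal{A}}(x)(f)y$. A representation of $\mathcal{A}$ on $E$ is a $C^\infty(M)$-linear map $x\mapsto\rho(x)$ from $\Gamma(\mathcal{A})$ to $\mathbb{R}$-linear operators on $\Gamma(E)$ with $\rho(x)(fu)=f\rho(x)u+a_{\mathcal{A}}(x)(f)u$ and $\rho([x,y]_{\mathcal{A}})=\rho(x)\rho(y)-\rho(y)\rho(x)$. A LieRep pair $(\mathcal{A};\rho)$ is a Lie algebroid with a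 representation $\rho$ on a vector bundle $E$. A relative Rota--Baxter operator on $(\mathcal{A};\rho)$ is a bundle map $T:E\to\mathcal{A}$ with $[T(u),T(v)]_{\mathcal{A}}=T(\rho(T(u))(v)-\rho(T(v))(u))$ for all $u,v\in\Gamma(E)$. $\mathcal{C}^k(E,\mathcal{A})=\Gamma(\mathrm{Hom}(\wedge^kE,\mathcal{A}))$ (degree $k$), $\mathcal{C}^*(E,\mathcal{A})=\oplus_{k\ge0}\mathcal{C}^k(E,\mathcal{A})$. For $P\in \mathcal{C}^n(E,\mathcal{A})$, $Q\in \mathcal{C}^m(E,\mathcal{A})$, $$\begin{aligned} [\![P,Q]\!](u_1,\dots,u_{m+n})={}&\sum_{\sigma\in\mathbb{S}_{(m,1,n-1)}} (-1)^\sigma P(\rho(Q(u_{\sigma(1)},\dots,u_{\sigma(m)}))u_{\sigma(m+1)},u_{\sigma(m+2)},\dots,u_{\sigma(m+n)})\\ &-(-1)^{mn}\sum_{\sigma\in\mathbb{S}_{(n,1,m-1)}} (-1)^\sigma Q(\rho(P(u_{\sigma(1)},\dots,u_{\sigma(n)}))u_{\sigma(n+1)},u_{\sigma(n+2)},\dots,u_{\sigma(m+n)})\\ &+(-1)^{mn}\sum_{\sigma\in\mathbb{S}_{(n,m)}} (-1)^\sigma [P(u_{\sigma(1)},\dots,u_{\sigma(n)}),Q(u_{\sigma(n+1)},\dots,u_{\sigma(m+n)})]_{\mathcal{A}}, \end{aligned}$$ where $\mathbb{S}_{(i_1,\dots,i_k)}$ is the set of unshuffles (permutations increasing on consecutive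 blocks of lengths $i_1,\dots,i_k$) and a sum involving a block of length $-1$ is zero. This makes $\mathcal{C}^*(E,\mathcal{A})$ a graded Lie algebra with $[\![T,T]\!]=0$ for every relative Rota--Baxter operator $T$, so $\tilde{\mathrm{d}}_T=[\![T,\cdot]\!]$ is a square-zero graded derivation. A Maurer--Cartan element of a differential graded Lie algebra $(\mathfrak{g},[\cdot,\cdot],d)$ is a degree $1$ element $\theta$ with $d\theta+\frac12[\theta,\theta]=0$. *)

theory Defs
  imports
    "HOL-Analysis.Analysis"
    "HOL-Library.Function_Algebras"
    "HOL-Combinatorics.Permutations"
begin

section \<open>Functions into a real vector space\<close>

text \<open>
  The pointwise vector space structure is used for sections, for tangent vectors (which are
  functionals on functions) and for cochains (which are operators on sections).
\<close>

instantiation "fun" :: (type, real_vector) real_vector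
begin

definition scaleR_fun :: "real \<Rightarrow> ('a \<Rightarrow> 'b) \<Rightarrow> 'a \<Rightarrow> 'b"
  where "scaleR_fun c f = (\<lambda>x. c *\<^sub>R f x)"

instance
  by standard (simp_all add: scaleR_fun_def fun_eq_iff algebra_simps)

end

definition linear_between :: "'a::real_vector set \<Rightarrow> 'b::real_vector set \<Rightarrow> ('a \<Rightarrow> 'b) \<Rightarrow> bool"
  where "linear_between V W f \<longleftrightarrow>
    (\<forall>u\<in>V. f u \<in> W) \<and>
    (\<forall>u\<in>V. \<forall>v\<in>V. f (u + v) = f u + f v) \<and>
    (\<forall>c. \<forall>u\<in>V. f (c *\<^sub>R u) = c *\<^sub>R f u)"


section \<open>Smooth manifolds\<close>

text \<open>
  The model space is \<^const>\<open>Euclidean_space\<close>: the n-dimensional one consists of the sequences of reals that vanish from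
  index n on. Unlike the types of class \<^class>\<open>euclidean_space\<close> it includes dimension 0,
  and ranks and dimensions can be added. The i-th partial derivative at z is the derivative of
  t \<mapsto> f (z(i := t)) at z i. For an open subset W of the model space, values of f outside W
  are irrelevant.
\<close>

primrec Ck_on :: "nat \<Rightarrow> nat \<Rightarrow> (nat \<Rightarrow> real) set \<Rightarrow> ((nat \<Rightarrow> real) \<Rightarrow> real) \<Rightarrow> bool"
  where
    "Ck_on n 0 W f \<longleftrightarrow>
      continuous_map (subtopology (Euclidean_space n) W) euclideanreal f"
  | "Ck_on n (Suc k) W f \<longleftrightarrow>
      continuous_map (subtopology (Euclidean_space n) W) euclideanreal f \<and>
      (\<forall>i<n. (\<forall>z\<in>W. (\<lambda>t. f (z(i := t))) field_differentiable at (z i)) \<and>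
             Ck_on n k W (\<lambda>z. deriv (\<lambda>t. f (z(i := t))) (z i)))"

definition Cinf_on :: "nat \<Rightarrow> (nat \<Rightarrow> real) set \<Rightarrow> ((nat \<Rightarrow> real) \<Rightarrow> real) \<Rightarrow> bool"
  where "Cinf_on n W f \<longleftrightarrow> (\<forall>k. Ck_on n k W f)"

type_synonym 'm chart = "'m set \<times> ('m \<Rightarrow> nat \<Rightarrow> real)"

text \<open>
  The underlying space of the manifold is the whole type \<open>'m\<close>; the type classes make it Hausdorff
  and second countable. The atlas need not be maximal.
\<close>

record 'm manifold =
  dim :: nat
  atlas :: "'m chart set"

definition is_chart :: "nat \<Rightarrow> 'm::topological_space chart \<Rightarrow> bool"
  where "is_chart n = (\<lambda>(U, x). open U \<and> openin (Euclidean_space n) (x ` U) \<and>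
    homeomorphic_map (top_of_set U) (subtopology (Euclidean_space n) (x ` U)) x)"

definition smooth_manifold :: "'m::{t2_space, second_countable_topology} manifold \<Rightarrow> bool"
  where "smooth_manifold M \<longleftrightarrow>
    (\<forall>c\<in>atlas M. is_chart (dim M) c) \<and>
    (\<Union>(U, x)\<in>atlas M. U) = UNIV \<and>
    (\<forall>(U, x)\<in>atlas M. \<forall>(V, y)\<in>atlas M. \<forall>i<dim M.
      Cinf_on (dim M) (x ` (U \<inter> V)) (\<lambda>z. y (inv_into U x z) i))"

definition smooth_on :: "'m manifold \<Rightarrow> 'm set \<Rightarrow> ('m \<Rightarrow> real) \<Rightarrow> bool"
  where "smooth_on M W f \<longleftrightarrow>
    (\<forall>(U, x)\<in>atlas M. Cinf_on (dim M) (x ` (U \<inter> W)) (\<lambda>z. f (inv_into U x z)))"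


section \<open>Vector bundles\<close>

text \<open>
  The fibre over p is a linear subspace of an arbitrary real vector space \<open>'e\<close> (not assumed to be
  finite-dimensional, and fibres over distinct points may overlap); the total space is the set of
  pairs (p, v) with v in the fibre over p. Any family of vector spaces is of this form, up to
  isomorphism, inside its direct sum. The topology and smooth structure of the total space are
  those determined by the local trivialisations, given as pairs (V, \<phi>) with \<phi> p an isomorphism of
  the fibre over p onto the model space of dimension the rank, for p in V.
\<close>

type_synonym ('m, 'e) triv = "'m set \<times> ('m \<Rightarrow> 'e \<Rightarrow> nat \<Rightarrow> real)"

record ('m, 'e) vbundle =
  fibre :: "'m \<Rightarrow> 'e set"
  rank :: nat
  trivs :: "('m, 'e) triv set"

definition unit_vec :: "nat \<Rightarrow> nat \<Rightarrow> real"
  where "unit_vec j = (\<lambda>i. if i = j then 1 else 0)"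

definition frame :: "('m, 'e) vbundle \<Rightarrow> ('m \<Rightarrow> 'e \<Rightarrow> nat \<Rightarrow> real) \<Rightarrow> 'm \<Rightarrow> nat \<Rightarrow> 'e"
  where "frame E \<phi> p j = inv_into (fibre E p) (\<phi> p) (unit_vec j)"

definition vector_bundle ::
    "'m::{t2_space, second_countable_topology} manifold \<Rightarrow> ('m, 'e::real_vector) vbundle \<Rightarrow> bool"
  where "vector_bundle M E \<longleftrightarrow>
    (\<forall>p. subspace (fibre E p)) \<and>
    (\<forall>(V, \<phi>)\<in>trivs E. open V \<and>
      (\<forall>p\<in>V. linear_between (fibre E p) (topspace (Euclidean_space (rank E))) (\<phi> p) \<and>
             bij_betw (\<phi> p) (fibre E p) (topspace (Euclidean_space (rank E))))) \<and>
    (\<Union>(V, \<phi>)\<in>trivs E. V) = UNIV \<and>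
    (\<forall>(V, \<phi>)\<in>trivs E. \<forall>(W, \<psi>)\<in>trivs E. \<forall>i<rank E. \<forall>j<rank E.
      smooth_on M (V \<inter> W) (\<lambda>p. \<psi> p (frame E \<phi> p j) i))"

definition sections :: "'m manifold \<Rightarrow> ('m, 'e) vbundle \<Rightarrow> ('m \<Rightarrow> 'e) set"
  where "sections M E = {u. (\<forall>p. u p \<in> fibre E p) \<and>
    (\<forall>(V, \<phi>)\<in>trivs E. \<forall>i<rank E. smooth_on M V (\<lambda>p. \<phi> p (u p) i))}"

definition fun_scale :: "('m \<Rightarrow> real) \<Rightarrow> ('m \<Rightarrow> 'e::real_vector) \<Rightarrow> 'm \<Rightarrow> 'e"
  where "fun_scale f u = (\<lambda>p. f p *\<^sub>R u p)"

text \<open>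
  Smoothness of a bundle map is smoothness as a map of total spaces: a point of the total space of
  E over U \<inter> V has, for a chart (U, x) and a trivialisation (V, \<phi>), as its dim M + rank E coordinates
  those of the base point followed by those of the vector.
\<close>

definition base_part :: "nat \<Rightarrow> (nat \<Rightarrow> real) \<Rightarrow> nat \<Rightarrow> real"
  where "base_part n z = (\<lambda>i. if i < n then z i else 0)"

definition fibre_part :: "nat \<Rightarrow> (nat \<Rightarrow> real) \<Rightarrow> nat \<Rightarrow> real"
  where "fibre_part n z = (\<lambda>i. z (n + i))"

definition bundle_map ::
    "'m manifold \<Rightarrow> ('m, 'e::real_vector) vbundle \<Rightarrow> ('m, 'f::real_vector) vbundle \<Rightarrow>
      ('m \<Rightarrow> 'e \<Rightarrow> 'f) \<Rightarrow> bool"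
  where "bundle_map M E F T \<longleftrightarrow>
    (\<forall>p. linear_between (fibre E p) (fibre F p) (T p)) \<and>
    (\<forall>(U, x)\<in>atlas M. \<forall>(V, \<phi>)\<in>trivs E. \<forall>(W, \<psi>)\<in>trivs F. \<forall>j<rank F.
      Cinf_on (dim M + rank E)
        {z \<in> topspace (Euclidean_space (dim M + rank E)). base_part (dim M) z \<in> x ` (U \<inter> V \<inter> W)}
        (\<lambda>z. let p = inv_into U x (base_part (dim M) z);
                  v = inv_into (fibre E p) (\<phi> p) (fibre_part (dim M) z)
              in \<psi> p (T p v) j))"

definition on_sections :: "('m \<Rightarrow> 'e \<Rightarrow> 'f) \<Rightarrow> ('m \<Rightarrow> 'e) \<Rightarrow> 'm \<Rightarrow> 'f"
  where "on_sections T u = (\<lambda>p. T p (u p))"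


section \<open>The tangent bundle\<close>

text \<open>
  Tangent vectors at p are the derivations at p of the algebra of germs of smooth functions. A
  derivation is a functional on all functions, invariant under changing the function away from p,
  and 0 on the functions that are not smooth near p.
\<close>

definition smooth_near :: "'m::topological_space manifold \<Rightarrow> 'm \<Rightarrow> ('m \<Rightarrow> real) set"
  where "smooth_near M p = {f. \<exists>W. open W \<and> p \<in> W \<and> smooth_on M W f}"

definition tangent_space :: "'m::topological_space manifold \<Rightarrow> 'm \<Rightarrow> (('m \<Rightarrow> real) \<Rightarrow> real) set"
  where "tangent_space M p = {D.
    (\<forall>f. f \<notin> smooth_near M p \<longrightarrow> D f = 0) \<and>
    (\<forall>f\<in>smooth_near M p. \<forall>g\<in>smooth_near M p. (\<forall>\<^sub>F q in nhds p. f q = g q) \<longrightarrow> D f = D g) \<and>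
    linear_between (smooth_near M p) UNIV D \<and>
    (\<forall>f\<in>smooth_near M p. \<forall>g\<in>smooth_near M p. D (\<lambda>q. f q * g q) = f p * D g + g p * D f)}"

definition tangent_bundle ::
    "'m::topological_space manifold \<Rightarrow> ('m, ('m \<Rightarrow> real) \<Rightarrow> real) vbundle"
  where "tangent_bundle M = \<lparr>
    fibre = tangent_space M,
    rank = dim M,
    trivs = {(U, \<lambda>p D i. if i < dim M then D (\<lambda>q. x q i) else 0) | U x. (U, x) \<in> atlas M}\<rparr>"


section \<open>Lie algebroids, representations, relative Rota--Baxter operators\<close>

record ('m, 'a) algebroid =
  bdl :: "('m, 'a) vbundle"
  brk :: "('m \<Rightarrow> 'a) \<Rightarrow> ('m \<Rightarrow> 'a) \<Rightarrow> 'm \<Rightarrow> 'a"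
  anchor :: "'m \<Rightarrow> 'a \<Rightarrow> ('m \<Rightarrow> real) \<Rightarrow> real"

definition anchor_act :: "('m, 'a) algebroid \<Rightarrow> ('m \<Rightarrow> 'a) \<Rightarrow> ('m \<Rightarrow> real) \<Rightarrow> 'm \<Rightarrow> real"
  where "anchor_act A x f = (\<lambda>p. anchor A p (x p) f)"

definition lie_algebroid ::
    "'m::{t2_space, second_countable_topology} manifold \<Rightarrow> ('m, 'a::real_vector) algebroid \<Rightarrow> bool"
  where "lie_algebroid M A \<longleftrightarrow> (let \<Gamma> = sections M (bdl A) in
    vector_bundle M (bdl A) \<and>
    bundle_map M (bdl A) (tangent_bundle M) (anchor A) \<and>
    (\<forall>x\<in>\<Gamma>. linear_between \<Gamma> \<Gamma> (\<lambda>y. brk A x y)) \<and>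
    (\<forall>y\<in>\<Gamma>. linear_between \<Gamma> \<Gamma> (\<lambda>x. brk A x y)) \<and>
    (\<forall>x\<in>\<Gamma>. brk A x x = 0) \<and>
    (\<forall>x\<in>\<Gamma>. \<forall>y\<in>\<Gamma>. \<forall>z\<in>\<Gamma>.
      brk A x (brk A y z) + brk A y (brk A z x) + brk A z (brk A x y) = 0) \<and>
    (\<forall>x\<in>\<Gamma>. \<forall>y\<in>\<Gamma>. \<forall>f. smooth_on M UNIV f \<longrightarrow>
      brk A x (fun_scale f y) = fun_scale f (brk A x y) + fun_scale (anchor_act A x f) y))"

definition representation ::
    "'m manifold \<Rightarrow> ('m, 'a::real_vector) algebroid \<Rightarrow> ('m, 'e::real_vector) vbundle \<Rightarrow>
      (('m \<Rightarrow> 'a) \<Rightarrow> ('m \<Rightarrow> 'e) \<Rightarrow> 'm \<Rightarrow> 'e) \<Rightarrow> bool"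
  where "representation M A E \<rho> \<longleftrightarrow> (let \<Gamma> = sections M (bdl A); \<Delta> = sections M E in
    (\<forall>x\<in>\<Gamma>. linear_between \<Delta> \<Delta> (\<rho> x)) \<and>
    (\<forall>x\<in>\<Gamma>. \<forall>y\<in>\<Gamma>. \<forall>u\<in>\<Delta>. \<rho> (x + y) u = \<rho> x u + \<rho> y u) \<and>
    (\<forall>x\<in>\<Gamma>. \<forall>u\<in>\<Delta>. \<forall>f. smooth_on M UNIV f \<longrightarrow>
      \<rho> (fun_scale f x) u = fun_scale f (\<rho> x u) \<and>
      \<rho> x (fun_scale f u) = fun_scale f (\<rho> x u) + fun_scale (anchor_act A x f) u) \<and>
    (\<forall>x\<in>\<Gamma>. \<forall>y\<in>\<Gamma>. \<forall>u\<in>\<Delta>. \<rho> (brk A x y) u = \<rho> x (\<rho> y u) - \<rho> y (\<rho> x u)))"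

definition lierep_pair ::
    "'m::{t2_space, second_countable_topology} manifold \<Rightarrow> ('m, 'a::real_vector) algebroid \<Rightarrow>
      ('m, 'e::real_vector) vbundle \<Rightarrow> (('m \<Rightarrow> 'a) \<Rightarrow> ('m \<Rightarrow> 'e) \<Rightarrow> 'm \<Rightarrow> 'e) \<Rightarrow> bool"
  where "lierep_pair M A E \<rho> \<longleftrightarrow>
    lie_algebroid M A \<and> vector_bundle M E \<and> representation M A E \<rho>"

definition relative_rota_baxter ::
    "'m manifold \<Rightarrow> ('m, 'a::real_vector) algebroid \<Rightarrow> ('m, 'e::real_vector) vbundle \<Rightarrow>
      (('m \<Rightarrow> 'a) \<Rightarrow> ('m \<Rightarrow> 'e) \<Rightarrow> 'm \<Rightarrow> 'e) \<Rightarrow> ('m \<Rightarrow> 'e \<Rightarrow> 'a) \<Rightarrow> bool"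
  where "relative_rota_baxter M A E \<rho> T \<longleftrightarrow>
    bundle_map M E (bdl A) T \<and>
    (\<forall>u\<in>sections M E. \<forall>v\<in>sections M E.
      brk A (on_sections T u) (on_sections T v) =
        on_sections T (\<rho> (on_sections T u) v - \<rho> (on_sections T v) u))"


section \<open>Cochains\<close>

text \<open>
  A linear map on the k-th exterior power of V is an alternating k-linear map on V, here a function
  on lists of length k.
\<close>

definition alternating_map ::
    "nat \<Rightarrow> 'e::real_vector set \<Rightarrow> 'a::real_vector set \<Rightarrow> ('e list \<Rightarrow> 'a) \<Rightarrow> bool"
  where "alternating_map k V W \<omega> \<longleftrightarrow>
    (\<forall>vs. length vs = k \<and> set vs \<subseteq> V \<longrightarrow>
      \<omega> vs \<in> W \<and>
      (\<forall>i<k. linear_between V W (\<lambda>v. \<omega> (vs[i := v]))) \<and>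
      (\<forall>i<k. \<forall>j<i. vs ! i = vs ! j \<longrightarrow> \<omega> vs = 0))"

definition hom_ext_sections ::
    "'m manifold \<Rightarrow> nat \<Rightarrow> ('m, 'e::real_vector) vbundle \<Rightarrow> ('m, 'a::real_vector) vbundle \<Rightarrow>
      ('m \<Rightarrow> 'e list \<Rightarrow> 'a) set"
  where "hom_ext_sections M k E F = {\<omega>.
    (\<forall>p. alternating_map k (fibre E p) (fibre F p) (\<omega> p)) \<and>
    (\<forall>(V, \<phi>)\<in>trivs E. \<forall>(W, \<psi>)\<in>trivs F. \<forall>js. length js = k \<and> set js \<subseteq> {..<rank E} \<longrightarrow>
      (\<forall>i<rank F. smooth_on M (V \<inter> W) (\<lambda>p. \<psi> p (\<omega> p (map (frame E \<phi> p) js)) i)))}"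

text \<open>
  As in the formula for the bracket, cochains are evaluated on sections of E: a section \<omega> of
  Hom(\<open>\<And>\<close>k E, F) is identified with the operator it induces on k-tuples of sections, extended by 0 to
  all other lists. Thus an element of the direct sum of all degrees is one function on lists of
  sections, whose degree k component is its restriction to lists of length k.
\<close>

definition cochain_of ::
    "'m manifold \<Rightarrow> nat \<Rightarrow> ('m, 'e) vbundle \<Rightarrow> ('m \<Rightarrow> 'e list \<Rightarrow> 'a::real_vector) \<Rightarrow>
      ('m \<Rightarrow> 'e) list \<Rightarrow> 'm \<Rightarrow> 'a"
  where "cochain_of M k E \<omega> us =
    (if length us = k \<and> set us \<subseteq> sections M E then (\<lambda>p. \<omega> p (map (\<lambda>u. u p) us)) else 0)"

definition cochains ::
    "'m manifold \<Rightarrow> ('m, 'e::real_vector) vbundle \<Rightarrow> ('m, 'a::real_vector) vbundle \<Rightarrow> nat \<Rightarrow>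
      (('m \<Rightarrow> 'e) list \<Rightarrow> 'm \<Rightarrow> 'a) set"
  where "cochains M E F k = cochain_of M k E ` hom_ext_sections M k E F"

definition bundle_map_cochain ::
    "'m manifold \<Rightarrow> ('m, 'e) vbundle \<Rightarrow> ('m \<Rightarrow> 'e \<Rightarrow> 'a::real_vector) \<Rightarrow>
      ('m \<Rightarrow> 'e) list \<Rightarrow> 'm \<Rightarrow> 'a"
  where "bundle_map_cochain M E T = cochain_of M 1 E (\<lambda>p vs. T p (hd vs))"


section \<open>The graded bracket\<close>

definition unshuffles :: "nat list \<Rightarrow> (nat \<Rightarrow> nat) set"
  where "unshuffles bs = {\<sigma>. \<sigma> permutes {..<sum_list bs} \<and>
    (\<forall>j<length bs. strict_mono_on {sum_list (take j bs)..<sum_list (take (Suc j) bs)} \<sigma>)}"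

definition pick :: "(nat \<Rightarrow> nat) \<Rightarrow> 'u list \<Rightarrow> nat \<Rightarrow> nat \<Rightarrow> 'u list"
  where "pick \<sigma> us a b = map (\<lambda>i. us ! \<sigma> i) [a..<b]"

definition insertion_sum ::
    "(('m \<Rightarrow> 'a) \<Rightarrow> ('m \<Rightarrow> 'e) \<Rightarrow> 'm \<Rightarrow> 'e) \<Rightarrow> nat \<Rightarrow> nat \<Rightarrow>
      (('m \<Rightarrow> 'e) list \<Rightarrow> 'm \<Rightarrow> 'a) \<Rightarrow> (('m \<Rightarrow> 'e) list \<Rightarrow> 'm \<Rightarrow> 'a) \<Rightarrow>
      ('m \<Rightarrow> 'e) list \<Rightarrow> 'm \<Rightarrow> 'a::real_vector"
  where "insertion_sum \<rho> n m P Q us =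
    (if n = 0 then 0
     else \<Sum>\<sigma>\<in>unshuffles [m, 1, n - 1]. of_int (sign \<sigma>) *\<^sub>R
       P (\<rho> (Q (pick \<sigma> us 0 m)) (us ! \<sigma> m) # pick \<sigma> us (m + 1) (m + n)))"

text \<open>
  \<open>hom_bracket A \<rho> n m P Q\<close> is the bracket of the degree n component of P with the degree m
  component of Q: P is only applied to lists of length n and Q to lists of length m.
\<close>

definition hom_bracket ::
    "('m, 'a::real_vector) algebroid \<Rightarrow> (('m \<Rightarrow> 'a) \<Rightarrow> ('m \<Rightarrow> 'e) \<Rightarrow> 'm \<Rightarrow> 'e) \<Rightarrow> nat \<Rightarrow> nat \<Rightarrow>
      (('m \<Rightarrow> 'e) list \<Rightarrow> 'm \<Rightarrow> 'a) \<Rightarrow> (('m \<Rightarrow> 'e) list \<Rightarrow> 'm \<Rightarrow> 'a) \<Rightarrow>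
      ('m \<Rightarrow> 'e) list \<Rightarrow> 'm \<Rightarrow> 'a"
  where "hom_bracket A \<rho> n m P Q us =
    insertion_sum \<rho> n m P Q us
    - ((-1) ^ (m * n)) *\<^sub>R insertion_sum \<rho> m n Q P us
    + ((-1) ^ (m * n)) *\<^sub>R (\<Sum>\<sigma>\<in>unshuffles [n, m]. of_int (sign \<sigma>) *\<^sub>R
        brk A (P (pick \<sigma> us 0 n)) (Q (pick \<sigma> us n (m + n))))"

definition graded_bracket ::
    "'m manifold \<Rightarrow> ('m, 'a::real_vector) algebroid \<Rightarrow> ('m, 'e) vbundle \<Rightarrow>
      (('m \<Rightarrow> 'a) \<Rightarrow> ('m \<Rightarrow> 'e) \<Rightarrow> 'm \<Rightarrow> 'e) \<Rightarrow>
      (('m \<Rightarrow> 'e) list \<Rightarrow> 'm \<Rightarrow> 'a) \<Rightarrow> (('m \<Rightarrow> 'e) list \<Rightarrow> 'm \<Rightarrow> 'a) \<Rightarrow>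
      ('m \<Rightarrow> 'e) list \<Rightarrow> 'm \<Rightarrow> 'a"
  where "graded_bracket M A E \<rho> P Q us =
    (if set us \<subseteq> sections M E
     then \<Sum>n\<le>length us. hom_bracket A \<rho> n (length us - n) P Q us
     else 0)"


section \<open>Maurer--Cartan elements\<close>

text \<open>
  The data of a differential graded Lie algebra: its homogeneous components inside a real vector
  space, whose direct sum is the underlying space, its bracket and its differential.
\<close>

record 'g dgla =
  component :: "nat \<Rightarrow> 'g set"
  bracket :: "'g \<Rightarrow> 'g \<Rightarrow> 'g"
  differential :: "'g \<Rightarrow> 'g"

definition maurer_cartan :: "'g::real_vector dgla \<Rightarrow> 'g \<Rightarrow> bool"
  where "maurer_cartan L \<theta> \<longleftrightarrow>
    \<theta> \<in> component L 1 \<and> differential L \<theta> + (1 / 2) *\<^sub>R bracket L \<theta> \<theta> = 0"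

definition rota_baxter_dgla ::
    "'m manifold \<Rightarrow> ('m, 'a::real_vector) algebroid \<Rightarrow> ('m, 'e::real_vector) vbundle \<Rightarrow>
      (('m \<Rightarrow> 'a) \<Rightarrow> ('m \<Rightarrow> 'e) \<Rightarrow> 'm \<Rightarrow> 'e) \<Rightarrow> ('m \<Rightarrow> 'e \<Rightarrow> 'a) \<Rightarrow>
      (('m \<Rightarrow> 'e) list \<Rightarrow> 'm \<Rightarrow> 'a) dgla"
  where "rota_baxter_dgla M A E \<rho> T = \<lparr>
    component = cochains M E (bdl A),
    bracket = graded_bracket M A E \<rho>,
    differential = graded_bracket M A E \<rho> (bundle_map_cochain M E T)\<rparr>"

end

theory Submission
  imports Defs
begin

text \<open>
  For bundle maps P and Q, regarded as cochains of degree 1, the bracket of P and Q is the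
  polarisation of the quadratic defect of the Rota--Baxter equation: on a pair of sections u, v the
  cochain of T + T' in degree 2 splits into the defect of T, the differential of T' and half the
  bracket of T' with itself. The first vanishes by hypothesis, so the other two cancel exactly
  when T + T' is again a Rota--Baxter operator. Bilinearity of the Lie bracket is only available on smooth
  sections, so bundle maps must be shown to preserve these. Expanding a section in a local frame
  reduces this to the product rule and the smoothness of the images of the frame; no chain rule is
  needed.
\<close>

section \<open>Differentiability on open subsets of the model space\<close>

lemma Ck_on_imp_continuous:
  "Ck_on n k W f \<Longrightarrow> continuous_map (subtopology (Euclidean_space n) W) euclideanreal f"
  by (cases k) auto

lemma Ck_on_imp_differentiable:
  "Ck_on n (Suc k) W f \<Longrightarrow> i < n \<Longrightarrow> z \<in> W \<Longrightarrow> (\<lambda>t. f (z(i := t))) field_differentiable at (z i)"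
  unfolding Ck_on.simps by (drule conjunct2, drule spec[of _ i], drule mp, assumption, drule conjunct1, erule bspec)

lemma Ck_on_deriv:
  "Ck_on n (Suc k) W f \<Longrightarrow> i < n \<Longrightarrow> Ck_on n k W (\<lambda>z. deriv (\<lambda>t. f (z(i := t))) (z i))"
  unfolding Ck_on.simps by (drule conjunct2, drule spec[of _ i], drule mp, assumption, erule conjunct2)

lemma Ck_on_SucI:
  assumes "continuous_map (subtopology (Euclidean_space n) W) euclideanreal f"
    and "\<And>i z. i < n \<Longrightarrow> z \<in> W \<Longrightarrow> (\<lambda>t. f (z(i := t))) field_differentiable at (z i)"
    and "\<And>i. i < n \<Longrightarrow> Ck_on n k W (\<lambda>z. deriv (\<lambda>t. f (z(i := t))) (z i))"
  shows "Ck_on n (Suc k) W f"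
  unfolding Ck_on.simps by (intro conjI allI impI ballI assms)

lemma Ck_on_Suc_imp: "Ck_on n (Suc k) W f \<Longrightarrow> Ck_on n k W f"
proof (induction k arbitrary: f)
  case 0
  then show ?case using Ck_on_imp_continuous by simp
next
  case (Suc k)
  show ?case
  proof (rule Ck_on_SucI)
    show "Ck_on n k W (\<lambda>z. deriv (\<lambda>t. f (z(i := t))) (z i))" if "i < n" for i
      by (rule Suc.IH[OF Ck_on_deriv[OF Suc.prems that]])
  qed (fact Ck_on_imp_continuous[OF Suc.prems], fact Ck_on_imp_differentiable[OF Suc.prems])
qed

text \<open>Partial derivatives are taken along coordinate lines of the ambient function and do not
  mention the set, so shrinking the set leaves them unchanged.\<close>

lemma Ck_on_subset:
  assumes "Ck_on n k W f" "W' \<subseteq> W"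
  shows "Ck_on n k W' f"
  using assms(1)
proof (induction k arbitrary: f)
  case 0
  then show ?case using assms(2) continuous_map_from_subtopology_mono by auto
next
  case (Suc k)
  show ?case
  proof (rule Ck_on_SucI)
    show "continuous_map (subtopology (Euclidean_space n) W') euclideanreal f"
      by (rule continuous_map_from_subtopology_mono[OF Ck_on_imp_continuous[OF Suc.prems] assms(2)])
    show "(\<lambda>t. f (z(i := t))) field_differentiable at (z i)" if "i < n" "z \<in> W'" for i z
      by (rule Ck_on_imp_differentiable[OF Suc.prems that(1) subsetD[OF assms(2) that(2)]])
    show "Ck_on n k W' (\<lambda>z. deriv (\<lambda>t. f (z(i := t))) (z i))" if "i < n" for i
      by (rule Suc.IH[OF Ck_on_deriv[OF Suc.prems that]])
  qed
qed

lemma continuous_map_update_coordinate: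
  assumes "z \<in> topspace (Euclidean_space n)" "i < n"
  shows "continuous_map euclideanreal (Euclidean_space n) (\<lambda>t. z(i := t))"
proof -
  \<comment> \<open>The update is rewritten with an explicit 0 from index \<open>n\<close> on, the
    shape required by the componentwise criterion; the two agree because \<open>z\<close> lies in
    the model space and \<open>i < n\<close>.\<close>
  have "continuous_map euclideanreal (Euclidean_space n)
      (\<lambda>t j. if j < n then (if j = i then t else z j) else 0)"
    unfolding continuous_map_componentwise_Euclidean_space by auto
  moreover have "(\<lambda>t j. if j < n then (if j = i then t else z j) else 0) = (\<lambda>t. z(i := t))"
    using assms by (auto simp: fun_eq_iff topspace_Euclidean_space)
  ultimately show ?thesis by simp
qed

text \<open>A coordinate line meets an open set in an open set of parameters. This is what makes
  partial derivatives at points of \<open>W\<close> depend only on values on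
  \<open>W\<close>.\<close>

lemma eventually_update_coordinate:
  assumes "openin (Euclidean_space n) W" "z \<in> W" "i < n"
  shows "\<forall>\<^sub>F t in nhds (z i). z(i := t) \<in> W"
proof -
  have z: "z \<in> topspace (Euclidean_space n)" using assms openin_subset by blast
  have "openin euclideanreal {t \<in> topspace euclideanreal. z(i := t) \<in> W}"
    using openin_continuous_map_preimage[OF continuous_map_update_coordinate[OF z assms(3)] assms(1)] .
  then have "open {t. z(i := t) \<in> W}" by simp
  then show ?thesis using assms(2) unfolding eventually_nhds by fastforce
qed

text \<open>On an open set, functions that agree also agree near each point along every coordinate
  line, so their partial derivatives agree on \<open>W\<close> and the induction continues. It
  allows derivatives to be replaced by formulas valid only at points of \<open>W\<close>.\<close>

lemma Ck_on_cong:
  assumes "openin (Euclidean_space n) W" "\<And>z. z \<in> W \<Longrightarrow> f z = g z" "Ck_on n k W f"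
  shows "Ck_on n k W g"
  using assms(2,3)
proof (induction k arbitrary: f g)
  case 0
  then show ?case by (auto elim: continuous_map_eq)
next
  case (Suc k)
  have ev: "\<forall>\<^sub>F t in nhds (z i). f (z(i := t)) = g (z(i := t))" if "z \<in> W" "i < n" for z i
    using eventually_update_coordinate[OF assms(1) that] by (rule eventually_mono) (rule Suc.prems)
  show ?case
  proof (rule Ck_on_SucI)
    show "continuous_map (subtopology (Euclidean_space n) W) euclideanreal g"
      by (rule continuous_map_eq[OF Ck_on_imp_continuous[OF Suc.prems(2)]])
        (simp add: Suc.prems(1))
    show "(\<lambda>t. g (z(i := t))) field_differentiable at (z i)" if "i < n" "z \<in> W" for i z
      using Ck_on_imp_differentiable[OF Suc.prems(2) that]
        DERIV_cong_ev[OF refl ev[OF that(2,1)] refl]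
      unfolding field_differentiable_def by blast
    show "Ck_on n k W (\<lambda>z. deriv (\<lambda>t. g (z(i := t))) (z i))" if "i < n" for i
      by (rule Suc.IH[OF deriv_cong_ev[OF ev[OF _ that] refl] Ck_on_deriv[OF Suc.prems(2) that]])
  qed
qed

lemma Ck_on_const: "Ck_on n k W (\<lambda>z. c)"
proof (induction k arbitrary: c)
  case (Suc k)
  show ?case by (rule Ck_on_SucI) (simp_all add: Suc.IH)
qed simp

lemma Ck_on_add:
  assumes "openin (Euclidean_space n) W" "Ck_on n k W f" "Ck_on n k W g"
  shows "Ck_on n k W (\<lambda>z. f z + g z)"
  using assms(2,3)
proof (induction k arbitrary: f g)
  case 0
  then show ?case by (auto intro: continuous_map_add)
next
  case (Suc k)
  note diff = Ck_on_imp_differentiable[OF Suc.prems(1)] Ck_on_imp_differentiable[OF Suc.prems(2)]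
  show ?case
  proof (rule Ck_on_SucI)
    show "continuous_map (subtopology (Euclidean_space n) W) euclideanreal (\<lambda>z. f z + g z)"
      using Suc.prems Ck_on_imp_continuous continuous_map_add by blast
    show "(\<lambda>t. f (z(i := t)) + g (z(i := t))) field_differentiable at (z i)"
      if "i < n" "z \<in> W" for i z
      by (intro Derivative.field_differentiable_add diff that)
    show "Ck_on n k W (\<lambda>z. deriv (\<lambda>t. f (z(i := t)) + g (z(i := t))) (z i))" if "i < n" for i
      \<comment> \<open>The sum rule for derivatives is available only at points of
        \<open>W\<close>, where both functions are differentiable; hence the passage through
        congruence.\<close>
      by (rule Ck_on_cong[OF assms(1) deriv_add[symmetric]])
        (intro diff that Suc.IH Ck_on_deriv Suc.prems | assumption)+
  qed
qed

lemma Ck_on_mult: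
  assumes "openin (Euclidean_space n) W" "Ck_on n k W f" "Ck_on n k W g"
  shows "Ck_on n k W (\<lambda>z. f z * g z)"
  using assms(2,3)
proof (induction k arbitrary: f g)
  case 0
  then show ?case by (auto intro: continuous_map_real_mult)
next
  case (Suc k)
  note diff = Ck_on_imp_differentiable[OF Suc.prems(1)] Ck_on_imp_differentiable[OF Suc.prems(2)]
  show ?case
  proof (rule Ck_on_SucI)
    show "continuous_map (subtopology (Euclidean_space n) W) euclideanreal (\<lambda>z. f z * g z)"
      using Suc.prems Ck_on_imp_continuous continuous_map_real_mult by blast
    show "(\<lambda>t. f (z(i := t)) * g (z(i := t))) field_differentiable at (z i)"
      if "i < n" "z \<in> W" for i z
      by (intro Derivative.field_differentiable_mult diff that)
    show "Ck_on n k W (\<lambda>z. deriv (\<lambda>t. f (z(i := t)) * g (z(i := t))) (z i))" if "i < n" for i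
    proof (rule Ck_on_cong[OF assms(1)])
      \<comment> \<open>Each Leibniz term multiplies a derivative of class k by an undifferentiated
        factor of class k + 1. The latter is weakened to class k so that the induction hypothesis
        covers both products.\<close>
      show "Ck_on n k W (\<lambda>z. f z * deriv (\<lambda>t. g (z(i := t))) (z i)
          + deriv (\<lambda>t. f (z(i := t))) (z i) * g z)"
        by (intro Ck_on_add[OF assms(1)] Suc.IH Ck_on_deriv Suc.prems that
            Ck_on_Suc_imp[OF Suc.prems(1)] Ck_on_Suc_imp[OF Suc.prems(2)])
      show "f z * deriv (\<lambda>t. g (z(i := t))) (z i) + deriv (\<lambda>t. f (z(i := t))) (z i) * g z
        = deriv (\<lambda>t. f (z(i := t)) * g (z(i := t))) (z i)" if "z \<in> W" for z
        by (subst deriv_mult[OF diff[OF \<open>i < n\<close> that]]) (simp only: fun_upd_triv)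
    qed
  qed
qed

lemma Ck_on_sum:
  assumes "openin (Euclidean_space n) W" "\<And>j. j \<in> J \<Longrightarrow> Ck_on n k W (f j)"
  shows "Ck_on n k W (\<lambda>z. \<Sum>j\<in>J. f j z)"
  using assms(2)
proof (induction J rule: infinite_finite_induct)
  case (insert j J)
  then show ?case using Ck_on_add[OF assms(1), of k "f j" "\<lambda>z. \<Sum>j\<in>J. f j z"] by simp
qed (simp_all add: Ck_on_const)

text \<open>Differentiability is a condition at each point, so only continuity has to be glued, by
  the pasting lemma for open covers. It is used to assemble smoothness over the trivialising sets of
  a bundle.\<close>

lemma Ck_on_Union:
  assumes "\<And>W. W \<in> \<W> \<Longrightarrow> openin (Euclidean_space n) W" "\<And>W. W \<in> \<W> \<Longrightarrow> Ck_on n k W f"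
  shows "Ck_on n k (\<Union>\<W>) f"
  using assms(2)
proof (induction k arbitrary: f)
  have cont: "continuous_map (subtopology (Euclidean_space n) (\<Union>\<W>)) euclideanreal f"
    if f: "\<And>W. W \<in> \<W> \<Longrightarrow> continuous_map (subtopology (Euclidean_space n) W) euclideanreal f" for f
  proof (rule pasting_lemma[where I = \<W> and T = "\<lambda>W. W" and f = "\<lambda>_. f"])
    show "openin (subtopology (Euclidean_space n) (\<Union>\<W>)) W" if "W \<in> \<W>" for W
      using assms(1)[OF that] that by (auto simp: openin_subtopology)
    show "continuous_map (subtopology (subtopology (Euclidean_space n) (\<Union>\<W>)) W) euclideanreal f"
      if "W \<in> \<W>" for W
      using f[OF that] that by (simp add: subtopology_subtopology Union_upper inf_absorb2)
  qed auto
  {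
    case 0
    then show ?case using cont by auto
  next
    case (Suc k)
    show ?case
    proof (rule Ck_on_SucI)
      show "continuous_map (subtopology (Euclidean_space n) (\<Union>\<W>)) euclideanreal f"
        using Suc.prems Ck_on_imp_continuous cont by blast
      show "(\<lambda>t. f (z(i := t))) field_differentiable at (z i)" if "i < n" "z \<in> \<Union>\<W>" for i z
        using Ck_on_imp_differentiable[OF Suc.prems] that by blast
      show "Ck_on n k (\<Union>\<W>) (\<lambda>z. deriv (\<lambda>t. f (z(i := t))) (z i))" if "i < n" for i
        by (rule Suc.IH[OF Ck_on_deriv[OF Suc.prems that]])
    qed
  }
qed

text \<open>Fixing a coordinate \<open>l\<close> beyond the first \<open>n\<close> commutes with
  differentiating in the directions \<open>i < n\<close>. Hence the partial derivatives of a slice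
  are slices of partial derivatives, which stands in for the chain rule.\<close>

lemma Ck_on_slice:
  assumes "Ck_on m k W' f" "n \<le> l" "l < m" "W \<subseteq> topspace (Euclidean_space n)"
    and "\<And>z. z \<in> W \<Longrightarrow> z(l := c) \<in> W'"
  shows "Ck_on n k W (\<lambda>z. f (z(l := c)))"
  using assms(1)
proof (induction k arbitrary: f)
  have "continuous_map (subtopology (Euclidean_space n) W) (Euclidean_space m)
      (\<lambda>z i. if i < m then (if i = l then c else z i) else 0)"
    unfolding continuous_map_componentwise_Euclidean_space
  proof (intro allI impI)
    fix i
    have "continuous_map (subtopology (Euclidean_space n) W) euclideanreal (\<lambda>z. z i)"
      unfolding Euclidean_space_def
      by (intro continuous_map_from_subtopology continuous_map_product_projection) auto
    then show "continuous_map (subtopology (Euclidean_space n) W) euclideanreal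
        (\<lambda>z. if i = l then c else z i)" by (cases "i = l") auto
  qed
  then have "continuous_map (subtopology (Euclidean_space n) W) (Euclidean_space m) (\<lambda>z. z(l := c))"
    by (rule continuous_map_eq) (use assms(2-4) in \<open>auto simp: fun_eq_iff topspace_Euclidean_space\<close>)
  then have "continuous_map (subtopology (Euclidean_space n) W)
      (subtopology (Euclidean_space m) W') (\<lambda>z. z(l := c))"
    using assms(5) by (auto simp: continuous_map_in_subtopology)
  then have cont: "continuous_map (subtopology (Euclidean_space n) W) euclideanreal (\<lambda>z. f (z(l := c)))"
    if "continuous_map (subtopology (Euclidean_space m) W') euclideanreal f" for f
    using continuous_map_compose[OF _ that] by (simp only: comp_def)
  {
    case 0
    then show ?case using cont unfolding Ck_on.simps by blast
  next
    case (Suc k)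
    \<comment> \<open>Since \<open>i < n\<close> and \<open>n \<le> l\<close>, the indices differ,
      so the updates commute and the base point of the derivative is unaffected.\<close>
    have upd: "z(i := t, l := c) = z(l := c, i := t)" "z i = (z(l := c)) i" if "i < n"
      for z :: "nat \<Rightarrow> real" and i t
      using that assms(2) by (auto simp: fun_eq_iff)
    show ?case
    proof (rule Ck_on_SucI)
      show "continuous_map (subtopology (Euclidean_space n) W) euclideanreal (\<lambda>z. f (z(l := c)))"
        by (rule cont[OF Ck_on_imp_continuous[OF Suc.prems]])
      show "(\<lambda>t. f (z(i := t, l := c))) field_differentiable at (z i)" if "i < n" "z \<in> W" for i z
        unfolding upd(1)[OF that(1)]
        by (subst upd(2)[OF that(1)], rule Ck_on_imp_differentiable[OF Suc.prems])
          (use that assms in auto)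
      show "Ck_on n k W (\<lambda>z. deriv (\<lambda>t. f (z(i := t, l := c))) (z i))" if "i < n" for i
        unfolding upd(1)[OF that]
        by (subst upd(2)[OF that], rule Suc.IH[OF Ck_on_deriv[OF Suc.prems]])
          (use that assms in auto)
    qed
  }
qed


section \<open>Fibrewise linear algebra\<close>

lemma linear_between_0: "linear_between V W f \<Longrightarrow> subspace V \<Longrightarrow> f 0 = 0"
  using subspace_0 unfolding linear_between_def by (metis scaleR_zero_left)

lemma linear_between_diff:
  assumes "linear_between V W f" "subspace V" "u \<in> V" "v \<in> V"
  shows "f (u - v) = f u - f v"
proof -
  have "f ((u - v) + v) = f (u - v) + f v"
    using assms subspace_diff[OF assms(2-4)] unfolding linear_between_def by blast
  then show ?thesis by simp
qed

lemma linear_between_add: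
  assumes "linear_between V W f" "linear_between V W g" "subspace W"
  shows "linear_between V W (\<lambda>v. f v + g v)"
  using assms unfolding linear_between_def by (auto simp: subspace_add algebra_simps)

lemma linear_between_sum:
  assumes "linear_between V W f" "subspace V" "\<And>j. j \<in> J \<Longrightarrow> b j \<in> V"
  shows "f (\<Sum>j\<in>J. c j *\<^sub>R b j) = (\<Sum>j\<in>J. c j *\<^sub>R f (b j))"
  using assms(3)
proof (induction J rule: infinite_finite_induct)
  case (insert j J)
  \<comment> \<open>Additivity of \<open>f\<close> is known only on \<open>V\<close>, so the partial
    sum has to be placed there first.\<close>
  have "(\<Sum>j\<in>J. c j *\<^sub>R b j) \<in> V"
    using insert.prems by (intro subspace_sum assms(2) subspace_scale) auto
  moreover have "c j *\<^sub>R b j \<in> V" using insert.prems assms(2) by (auto intro: subspace_scale)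
  ultimately have "f (c j *\<^sub>R b j + (\<Sum>j\<in>J. c j *\<^sub>R b j)) = f (c j *\<^sub>R b j) + f (\<Sum>j\<in>J. c j *\<^sub>R b j)"
    using assms(1) unfolding linear_between_def by blast
  moreover have "f (c j *\<^sub>R b j) = c j *\<^sub>R f (b j)"
    using assms(1) insert.prems unfolding linear_between_def by blast
  ultimately show ?case using insert by simp
qed (use linear_between_0[OF assms(1,2)] in simp_all)

lemma sum_fun_apply: "(\<Sum>j\<in>J. f j) x = (\<Sum>j\<in>J. f j x)" for f :: "'i \<Rightarrow> 'a \<Rightarrow> 'b::comm_monoid_add"
  by (induction J rule: infinite_finite_induct) auto

lemma unit_vec_in_Euclidean_space: "j < r \<Longrightarrow> unit_vec j \<in> topspace (Euclidean_space r)"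
  by (auto simp: unit_vec_def topspace_Euclidean_space)

lemma Euclidean_space_expansion:
  assumes "x \<in> topspace (Euclidean_space r)"
  shows "x = (\<Sum>j<r. x j *\<^sub>R unit_vec j)"
proof
  fix i
  have "(\<Sum>j<r. x j *\<^sub>R unit_vec j) i = (\<Sum>j<r. if i = j then x j else 0)"
    unfolding sum_fun_apply by (intro sum.cong) (auto simp: scaleR_fun_def unit_vec_def)
  \<comment> \<open>For \<open>i \<ge> r\<close> no summand survives, and \<open>x i\<close>
    vanishes by membership in the model space.\<close>
  also have "\<dots> = x i" using assms by (simp add: topspace_Euclidean_space)
  finally show "x i = (\<Sum>j<r. x j *\<^sub>R unit_vec j) i" by simp
qed

lemma subspace_fibre: "vector_bundle M E \<Longrightarrow> subspace (fibre E p)"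
  unfolding vector_bundle_def by blast

lemma vector_bundle_trivs_cover: "vector_bundle M E \<Longrightarrow> (\<Union>(V, \<phi>)\<in>trivs E. V) = UNIV"
  unfolding vector_bundle_def by blast

lemma open_triv: "vector_bundle M E \<Longrightarrow> (V, \<phi>) \<in> trivs E \<Longrightarrow> open V"
  unfolding vector_bundle_def by blast

lemma linear_triv:
  "vector_bundle M E \<Longrightarrow> (V, \<phi>) \<in> trivs E \<Longrightarrow> p \<in> V \<Longrightarrow>
    linear_between (fibre E p) (topspace (Euclidean_space (rank E))) (\<phi> p)"
  unfolding vector_bundle_def by blast

lemma bij_betw_triv:
  "vector_bundle M E \<Longrightarrow> (V, \<phi>) \<in> trivs E \<Longrightarrow> p \<in> V \<Longrightarrow>
    bij_betw (\<phi> p) (fibre E p) (topspace (Euclidean_space (rank E)))"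
  unfolding vector_bundle_def by blast

lemma frame_in_fibre:
  assumes "vector_bundle M E" "(V, \<phi>) \<in> trivs E" "p \<in> V" "j < rank E"
  shows "frame E \<phi> p j \<in> fibre E p" "\<phi> p (frame E \<phi> p j) = unit_vec j"
  using bij_betw_triv[OF assms(1-3)] unit_vec_in_Euclidean_space[OF assms(4)]
  unfolding frame_def bij_betw_def by (metis inv_into_into, metis f_inv_into_f)

text \<open>The trivialisation is injective on the fibre, so it suffices to compare coordinates, and
  these agree by the expansion in unit vectors.\<close>

lemma frame_expansion:
  assumes "vector_bundle M E" "(V, \<phi>) \<in> trivs E" "p \<in> V" "v \<in> fibre E p"
  shows "v = (\<Sum>j<rank E. \<phi> p v j *\<^sub>R frame E \<phi> p j)"
proof (rule inj_onD)
  note fr = frame_in_fibre[OF assms(1-3)]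
  show "inj_on (\<phi> p) (fibre E p)" using bij_betw_triv[OF assms(1-3)] bij_betw_def by blast
  show "(\<Sum>j<rank E. \<phi> p v j *\<^sub>R frame E \<phi> p j) \<in> fibre E p"
    by (intro subspace_sum subspace_scale subspace_fibre[OF assms(1)] fr) auto
  have "\<phi> p (\<Sum>j<rank E. \<phi> p v j *\<^sub>R frame E \<phi> p j) = (\<Sum>j<rank E. \<phi> p v j *\<^sub>R unit_vec j)"
    by (subst linear_between_sum[OF linear_triv[OF assms(1-3)] subspace_fibre[OF assms(1)]])
      (auto simp: fr)
  also have "\<dots> = \<phi> p v"
    by (rule Euclidean_space_expansion[symmetric])
      (use linear_triv[OF assms(1-3)] assms(4) in \<open>auto simp: linear_between_def\<close>)
  finally show "\<phi> p v = \<phi> p (\<Sum>j<rank E. \<phi> p v j *\<^sub>R frame E \<phi> p j)" by simp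
qed (fact assms(4))


section \<open>Smooth functions on a manifold\<close>

lemma chart_inj_on: "smooth_manifold M \<Longrightarrow> (U, x) \<in> atlas M \<Longrightarrow> inj_on x U"
  unfolding smooth_manifold_def is_chart_def using homeomorphic_imp_injective_map by fastforce

text \<open>The chart is a homeomorphism onto an image that is itself open in the model space, so
  relatively open images are open there. This supplies the openness hypothesis for the calculus on
  chart images.\<close>

lemma openin_chart_image:
  assumes "smooth_manifold M" "(U, x) \<in> atlas M" "open S"
  shows "openin (Euclidean_space (dim M)) (x ` (U \<inter> S))"
proof -
  have ch: "openin (Euclidean_space (dim M)) (x ` U)"
    "homeomorphic_map (top_of_set U) (subtopology (Euclidean_space (dim M)) (x ` U)) x"
    using assms(1,2) unfolding smooth_manifold_def is_chart_def by fastforce+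
  have "openin (top_of_set U) (U \<inter> S)" using assms(3) by (rule openin_open_Int)
  then have "openin (subtopology (Euclidean_space (dim M)) (x ` U)) (x ` (U \<inter> S))"
    using homeomorphic_map_openness[OF ch(2), of "U \<inter> S"] by simp
  then show ?thesis using ch(1) openin_trans_full by blast
qed

lemma inv_chart_in:
  assumes "smooth_manifold M" "(U, x) \<in> atlas M" "z \<in> x ` (U \<inter> S)"
  shows "inv_into U x z \<in> U \<inter> S"
  using assms(3) inv_into_f_f[OF chart_inj_on[OF assms(1,2)]] by auto

lemma smooth_on_cong:
  assumes "smooth_manifold M" "open W" "\<And>p. p \<in> W \<Longrightarrow> f p = g p" "smooth_on M W f"
  shows "smooth_on M W g"
  unfolding smooth_on_def Cinf_on_def
proof (clarify)
  fix U x k assume c: "(U, x) \<in> atlas M"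
  then have "Ck_on (dim M) k (x ` (U \<inter> W)) (\<lambda>z. f (inv_into U x z))"
    using assms(4) unfolding smooth_on_def Cinf_on_def by blast
  then show "Ck_on (dim M) k (x ` (U \<inter> W)) (\<lambda>z. g (inv_into U x z))"
    by (rule Ck_on_cong[OF openin_chart_image[OF assms(1) c assms(2)], rotated])
      (use inv_chart_in[OF assms(1) c] assms(3) in blast)
qed

lemma smooth_on_const: "smooth_on M W (\<lambda>p. c)"
  unfolding smooth_on_def Cinf_on_def using Ck_on_const by blast

lemma smooth_on_subset: "smooth_on M W f \<Longrightarrow> W' \<subseteq> W \<Longrightarrow> smooth_on M W' f"
  unfolding smooth_on_def Cinf_on_def
  by (clarify, rule Ck_on_subset[of _ _ "_ ` (_ \<inter> W)"]) blast+

lemma smooth_on_add: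
  assumes "smooth_manifold M" "open W" "smooth_on M W f" "smooth_on M W g"
  shows "smooth_on M W (\<lambda>p. f p + g p)"
  unfolding smooth_on_def Cinf_on_def
  by (clarify, rule Ck_on_add[OF openin_chart_image[OF assms(1) _ assms(2)]])
    (use assms(3,4) in \<open>auto simp: smooth_on_def Cinf_on_def\<close>)

lemma smooth_on_mult:
  assumes "smooth_manifold M" "open W" "smooth_on M W f" "smooth_on M W g"
  shows "smooth_on M W (\<lambda>p. f p * g p)"
  unfolding smooth_on_def Cinf_on_def
  by (clarify, rule Ck_on_mult[OF openin_chart_image[OF assms(1) _ assms(2)]])
    (use assms(3,4) in \<open>auto simp: smooth_on_def Cinf_on_def\<close>)

lemma smooth_on_sum:
  assumes "smooth_manifold M" "open W" "\<And>j. j \<in> J \<Longrightarrow> smooth_on M W (f j)"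
  shows "smooth_on M W (\<lambda>p. \<Sum>j\<in>J. f j p)"
  unfolding smooth_on_def Cinf_on_def
  by (clarify, rule Ck_on_sum[OF openin_chart_image[OF assms(1) _ assms(2)]])
    (use assms(3) in \<open>unfold smooth_on_def Cinf_on_def, blast\<close>)+

text \<open>In a fixed chart the image of the union is the union of the images, which reduces gluing
  to the model space.\<close>

lemma smooth_on_Union:
  assumes "smooth_manifold M" "\<And>W. W \<in> \<W> \<Longrightarrow> open W" "\<And>W. W \<in> \<W> \<Longrightarrow> smooth_on M W f"
  shows "smooth_on M (\<Union>\<W>) f"
  unfolding smooth_on_def Cinf_on_def
proof clarify
  fix U x k assume c: "(U, x) \<in> atlas M"
  have "Ck_on (dim M) k (\<Union>((\<lambda>W. x ` (U \<inter> W)) ` \<W>)) (\<lambda>z. f (inv_into U x z))"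
  proof (rule Ck_on_Union)
    fix S assume "S \<in> (\<lambda>W. x ` (U \<inter> W)) ` \<W>"
    then obtain W where W: "W \<in> \<W>" "S = x ` (U \<inter> W)" by blast
    show "openin (Euclidean_space (dim M)) S"
      unfolding W by (rule openin_chart_image[OF assms(1) c assms(2)[OF W(1)]])
    show "Ck_on (dim M) k S (\<lambda>z. f (inv_into U x z))"
      using assms(3)[OF W(1)] c unfolding W smooth_on_def Cinf_on_def by blast
  qed
  moreover have "(\<Union>((\<lambda>W. x ` (U \<inter> W)) ` \<W>)) = x ` (U \<inter> \<Union>\<W>)" by blast
  ultimately show "Ck_on (dim M) k (x ` (U \<inter> \<Union>\<W>)) (\<lambda>z. f (inv_into U x z))" by simp
qed


section \<open>Bundle maps and sections\<close>

lemma zero_in_sections: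
  assumes "smooth_manifold M" "vector_bundle M E"
  shows "0 \<in> sections M E"
proof -
  have "smooth_on M V (\<lambda>p. \<phi> p (0 p) i)" if t: "(V, \<phi>) \<in> trivs E" for V \<phi> i
  proof (rule smooth_on_cong[OF assms(1) open_triv[OF assms(2) t]])
    show "0 = \<phi> p (0 p) i" if "p \<in> V" for p
      using linear_between_0[OF linear_triv[OF assms(2) t that] subspace_fibre[OF assms(2)]] by simp
  qed (rule smooth_on_const)
  then show ?thesis
    unfolding sections_def using subspace_0[OF subspace_fibre[OF assms(2)]] by auto
qed

lemma add_in_sections:
  assumes "smooth_manifold M" "vector_bundle M E" "u \<in> sections M E" "v \<in> sections M E"
  shows "u + v \<in> sections M E"
proof -
  have uv: "u p \<in> fibre E p" "v p \<in> fibre E p" for p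
    using assms(3,4) unfolding sections_def by blast+
  have "smooth_on M V (\<lambda>p. \<phi> p ((u + v) p) i)" if t: "(V, \<phi>) \<in> trivs E" and i: "i < rank E" for V \<phi> i
  proof (rule smooth_on_cong[OF assms(1) open_triv[OF assms(2) t]])
    show "\<phi> p (u p) i + \<phi> p (v p) i = \<phi> p ((u + v) p) i" if "p \<in> V" for p
      using linear_triv[OF assms(2) t that] uv[of p] by (simp add: linear_between_def)
    show "smooth_on M V (\<lambda>p. \<phi> p (u p) i + \<phi> p (v p) i)"
      using assms(3,4) t i
      by (intro smooth_on_add[OF assms(1) open_triv[OF assms(2) t]]) (auto simp: sections_def)
  qed
  then show ?thesis
    unfolding sections_def using subspace_add[OF subspace_fibre[OF assms(2)]] uv by auto
qed

lemma bundle_map_linear: "bundle_map M E F T \<Longrightarrow> linear_between (fibre E p) (fibre F p) (T p)"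
  unfolding bundle_map_def by blast

lemma bundle_map_Ck_on:
  assumes "bundle_map M E F T" "(U, x) \<in> atlas M" "(V, \<phi>) \<in> trivs E" "(W, \<psi>) \<in> trivs F" "i < rank F"
  shows "Ck_on (dim M + rank E) k
    {z \<in> topspace (Euclidean_space (dim M + rank E)). base_part (dim M) z \<in> x ` (U \<inter> V \<inter> W)}
    (\<lambda>z. let p = inv_into U x (base_part (dim M) z);
             v = inv_into (fibre E p) (\<phi> p) (fibre_part (dim M) z)
         in \<psi> p (T p v) i)"
  using assms unfolding bundle_map_def Cinf_on_def by blast

text \<open>The frame vector j is the slice of the total space on which the fibre coordinates are constant,
  equal to the unit vector j.\<close>

lemma smooth_on_bundle_map_frame:
  assumes M: "smooth_manifold M" and E: "vector_bundle M E" and F: "vector_bundle M F"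
    and T: "bundle_map M E F T" and t: "(V, \<phi>) \<in> trivs E" "(W, \<psi>) \<in> trivs F"
    and ij: "j < rank E" "i < rank F"
  shows "smooth_on M (V \<inter> W) (\<lambda>p. \<psi> p (T p (frame E \<phi> p j)) i)"
  unfolding smooth_on_def Cinf_on_def
proof clarify
  fix U x k assume c: "(U, x) \<in> atlas M"
  define n where "n = dim M"
  have op: "openin (Euclidean_space n) (x ` (U \<inter> (V \<inter> W)))"
    unfolding n_def using M c open_triv[OF E t(1)] open_triv[OF F t(2)]
    by (intro openin_chart_image) auto
  then have sub: "x ` (U \<inter> (V \<inter> W)) \<subseteq> topspace (Euclidean_space n)" by (rule openin_subset)
  \<comment> \<open>Fibre coordinate \<open>j\<close> occupies slot \<open>n + j\<close>. As
    \<open>z\<close> vanishes from index \<open>n\<close> on, putting 1 there keeps the base point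
    and produces exactly the unit vector.\<close>
  have bp: "base_part n (z(n + j := 1)) = z" and fp: "fibre_part n (z(n + j := 1)) = unit_vec j"
    if "z \<in> x ` (U \<inter> (V \<inter> W))" for z
    using subsetD[OF sub that]
    by (auto simp: base_part_def fibre_part_def unit_vec_def fun_eq_iff topspace_Euclidean_space)
  show "Ck_on (dim M) k (x ` (U \<inter> (V \<inter> W)))
      (\<lambda>z. \<psi> (inv_into U x z) (T (inv_into U x z) (frame E \<phi> (inv_into U x z) j)) i)"
    unfolding n_def[symmetric]
    by (rule Ck_on_cong[OF op _ Ck_on_slice[OF bundle_map_Ck_on[OF T c t ij(2), folded n_def],
            of n "n + j" "x ` (U \<inter> (V \<inter> W))" 1]])
      (use ij sub in \<open>auto simp: bp fp Let_def frame_def Int_assoc topspace_Euclidean_space\<close>)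
qed

text \<open>Locally the coordinates of the image are the matrix of \<open>T\<close> in the frame
  applied to the coordinates of \<open>u\<close>, hence sums of products of smooth
  functions.\<close>

lemma on_sections_in_sections:
  assumes M: "smooth_manifold M" and E: "vector_bundle M E" and F: "vector_bundle M F"
    and T: "bundle_map M E F T" and u: "u \<in> sections M E"
  shows "on_sections T u \<in> sections M F"
proof -
  have uf: "u p \<in> fibre E p" for p using u unfolding sections_def by blast
  have "smooth_on M W (\<lambda>p. \<psi> p (T p (u p)) i)" if W: "(W, \<psi>) \<in> trivs F" "i < rank F" for W \<psi> i
  proof -
    have opW: "open W" by (rule open_triv[OF F W(1)])
    \<comment> \<open>The matrix formula needs a trivialisation of \<open>E\<close>, so it gives
      smoothness only on each \<open>V \<inter> W\<close>. These sets cover \<open>W\<close> as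
      \<open>V\<close> ranges over the trivialising sets.\<close>
    have "smooth_on M (\<Union>((\<lambda>(V, \<phi>). V \<inter> W) ` trivs E)) (\<lambda>p. \<psi> p (T p (u p)) i)"
    proof (rule smooth_on_Union[OF M])
      fix S assume "S \<in> (\<lambda>(V, \<phi>). V \<inter> W) ` trivs E"
      then obtain V \<phi> where V: "(V, \<phi>) \<in> trivs E" and S: "S = V \<inter> W" by auto
      show opS: "open S" unfolding S using open_triv[OF E V] opW by blast
      show "smooth_on M S (\<lambda>p. \<psi> p (T p (u p)) i)"
      proof (rule smooth_on_cong[OF M opS])
        show "(\<Sum>j<rank E. \<phi> p (u p) j * \<psi> p (T p (frame E \<phi> p j)) i) = \<psi> p (T p (u p)) i"
          if p: "p \<in> S" for p
        proof -
          have pV: "p \<in> V" "p \<in> W" using p S by auto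
          note fr = frame_in_fibre(1)[OF E V pV(1)]
          have "\<psi> p (T p (u p)) = \<psi> p (T p (\<Sum>j<rank E. \<phi> p (u p) j *\<^sub>R frame E \<phi> p j))"
            using frame_expansion[OF E V pV(1) uf] by simp
          also have "\<dots> = \<psi> p (\<Sum>j<rank E. \<phi> p (u p) j *\<^sub>R T p (frame E \<phi> p j))"
            by (subst linear_between_sum[OF bundle_map_linear[OF T] subspace_fibre[OF E]])
              (auto simp: fr)
          also have "\<dots> = (\<Sum>j<rank E. \<phi> p (u p) j *\<^sub>R \<psi> p (T p (frame E \<phi> p j)))"
            by (rule linear_between_sum[OF linear_triv[OF F W(1) pV(2)] subspace_fibre[OF F]])
              (use bundle_map_linear[OF T] fr in \<open>auto simp: linear_between_def\<close>)
          finally show ?thesis by (simp add: sum_fun_apply scaleR_fun_def)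
        qed
        have "smooth_on M S (\<lambda>p. \<phi> p (u p) j)" if "j < rank E" for j
          by (rule smooth_on_subset[of M V]) (use u V that S in \<open>auto simp: sections_def\<close>)
        then show "smooth_on M S (\<lambda>p. \<Sum>j<rank E. \<phi> p (u p) j * \<psi> p (T p (frame E \<phi> p j)) i)"
          unfolding S using smooth_on_bundle_map_frame[OF M E F T V W(1) _ W(2)] opS S
          by (intro smooth_on_sum[OF M] smooth_on_mult[OF M]) auto
      qed
    qed
    moreover have "\<Union>((\<lambda>(V, \<phi>). V \<inter> W) ` trivs E) = W"
      using vector_bundle_trivs_cover[OF E] by auto
    ultimately show ?thesis by simp
  qed
  then show ?thesis
    using bundle_map_linear[OF T] uf unfolding sections_def on_sections_def linear_between_def
    by blast
qed

lemma openin_total_space_chart: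
  assumes "openin (Euclidean_space n) S"
  shows "openin (Euclidean_space (n + r)) {z \<in> topspace (Euclidean_space (n + r)). base_part n z \<in> S}"
proof (rule openin_continuous_map_preimage[OF _ assms])
  show "continuous_map (Euclidean_space (n + r)) (Euclidean_space n) (base_part n)"
    unfolding base_part_def continuous_map_componentwise_Euclidean_space
    unfolding Euclidean_space_def
    by (auto intro!: continuous_map_from_subtopology continuous_map_product_projection)
qed

text \<open>Being a bundle map is part of being a relative Rota--Baxter operator, so it must be
  checked for the sum. In total-space coordinates the sum is represented by the sum of the two
  representing functions.\<close>

lemma bundle_map_add:
  assumes M: "smooth_manifold M" and E: "vector_bundle M E" and F: "vector_bundle M F"
    and T: "bundle_map M E F T" and T': "bundle_map M E F T'"
  shows "bundle_map M E F (T + T')"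
  unfolding bundle_map_def Cinf_on_def
proof (intro conjI, safe)
  fix p
  show "linear_between (fibre E p) (fibre F p) ((T + T') p)"
    using linear_between_add[OF bundle_map_linear[OF T] bundle_map_linear[OF T'] subspace_fibre[OF F]]
    by (simp add: plus_fun_def)
next
  fix U x V \<phi> W \<psi> i k
  assume c: "(U, x) \<in> atlas M" and t: "(V, \<phi>) \<in> trivs E" "(W, \<psi>) \<in> trivs F" and i: "i < rank F"
  let ?n = "dim M" and ?r = "rank E"
  let ?S = "{z \<in> topspace (Euclidean_space (?n + ?r)). base_part ?n z \<in> x ` (U \<inter> V \<inter> W)}"
  have "openin (Euclidean_space ?n) (x ` (U \<inter> (V \<inter> W)))"
    using M c open_triv[OF E t(1)] open_triv[OF F t(2)] by (intro openin_chart_image) auto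
  then have op: "openin (Euclidean_space (?n + ?r)) ?S"
    unfolding Int_assoc by (rule openin_total_space_chart)
  show "Ck_on (?n + ?r) k ?S
    (\<lambda>z. let p = inv_into U x (base_part ?n z);
             v = inv_into (fibre E p) (\<phi> p) (fibre_part ?n z)
         in \<psi> p ((T + T') p v) i)"
  proof (rule Ck_on_cong[OF op _ Ck_on_add[OF op bundle_map_Ck_on[OF T c t i] bundle_map_Ck_on[OF T' c t i]]])
    fix z assume z: "z \<in> ?S"
    define p where "p = inv_into U x (base_part ?n z)"
    define v where "v = inv_into (fibre E p) (\<phi> p) (fibre_part ?n z)"
    have p: "p \<in> V" "p \<in> W"
      using z inv_chart_in[OF M c, of "base_part ?n z" "V \<inter> W"] unfolding p_def by (auto simp: Int_assoc)
    \<comment> \<open>The inverse trivialisation lands in the fibre only on its image. Membership of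
      \<open>v\<close> in the fibre then makes linearity of \<open>\<psi> p\<close> applicable to
      the two image vectors.\<close>
    have "fibre_part ?n z \<in> topspace (Euclidean_space ?r)"
      using z by (auto simp: fibre_part_def topspace_Euclidean_space)
    then have "v \<in> fibre E p"
      using bij_betw_triv[OF E t(1) p(1)] unfolding v_def bij_betw_def by (metis inv_into_into)
    then have "\<psi> p (T p v + T' p v) = \<psi> p (T p v) + \<psi> p (T' p v)"
      using linear_triv[OF F t(2) p(2)] bundle_map_linear[OF T] bundle_map_linear[OF T']
      unfolding linear_between_def by blast
    then show "(let p = inv_into U x (base_part ?n z); v = inv_into (fibre E p) (\<phi> p) (fibre_part ?n z)
         in \<psi> p (T p v) i) +
      (let p = inv_into U x (base_part ?n z); v = inv_into (fibre E p) (\<phi> p) (fibre_part ?n z)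
         in \<psi> p (T' p v) i) =
      (let p = inv_into U x (base_part ?n z); v = inv_into (fibre E p) (\<phi> p) (fibre_part ?n z)
         in \<psi> p ((T + T') p v) i)"
      unfolding p_def v_def by (simp add: Let_def)
  qed
qed

text \<open>This discharges the degree condition on a Maurer--Cartan element. For lists of length 1
  the alternating condition is vacuous, and smoothness is tested on single frame vectors.\<close>

lemma bundle_map_cochain_in_cochains:
  assumes M: "smooth_manifold M" and E: "vector_bundle M E" and F: "vector_bundle M F"
    and T: "bundle_map M E F T"
  shows "bundle_map_cochain M E T \<in> cochains M E F 1"
  unfolding cochains_def bundle_map_cochain_def
proof (rule imageI)
  have "alternating_map 1 (fibre E p) (fibre F p) (\<lambda>vs. T p (hd vs))" for p
    unfolding alternating_map_def
  proof (intro allI impI)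
    fix vs assume "length vs = 1 \<and> set vs \<subseteq> fibre E p"
    then obtain v where "vs = [v]" "v \<in> fibre E p" by (auto simp: length_Suc_conv)
    then show "T p (hd vs) \<in> fibre F p \<and>
        (\<forall>i<1. linear_between (fibre E p) (fibre F p) (\<lambda>v. T p (hd (vs[i := v])))) \<and>
        (\<forall>i<1. \<forall>j<i. vs ! i = vs ! j \<longrightarrow> T p (hd vs) = 0)"
      using bundle_map_linear[OF T, of p] by (simp add: linear_between_def)
  qed
  moreover have "smooth_on M (V \<inter> W) (\<lambda>p. \<psi> p (T p (hd (map (frame E \<phi> p) js))) i)"
    if t: "(V, \<phi>) \<in> trivs E" "(W, \<psi>) \<in> trivs F" and js: "length js = 1" "set js \<subseteq> {..<rank E}"
      and i: "i < rank F" for V \<phi> W \<psi> js i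
  proof -
    obtain j where "js = [j]" "j < rank E" using js by (auto simp: length_Suc_conv)
    then show ?thesis using smooth_on_bundle_map_frame[OF M E F T t _ i] by simp
  qed
  ultimately show "(\<lambda>p vs. T p (hd vs)) \<in> hom_ext_sections M 1 E F"
    unfolding hom_ext_sections_def by blast
qed


section \<open>The bracket in degree one\<close>

lemma permutes_2_iff: "\<sigma> permutes {..<2::nat} \<longleftrightarrow> \<sigma> = id \<or> \<sigma> = Transposition.transpose 0 1"
proof -
  have "{..<2::nat} = {0, 1}" by auto
  then show ?thesis using permutes_doubleton_iff by metis
qed

text \<open>Blocks of length 1 impose no monotonicity, so every permutation of two points
  qualifies.\<close>

lemma unshuffles_1_1: "unshuffles [1, 1] = {id, Transposition.transpose 0 1}"
  unfolding unshuffles_def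
  by (auto simp: permutes_2_iff[unfolded numeral_2_eq_2] less_Suc_eq strict_mono_on_def)

lemma unshuffles_1_1_0: "unshuffles [1, 1, 0] = {id, Transposition.transpose 0 1}"
  unfolding unshuffles_def
  by (auto simp: permutes_2_iff[unfolded numeral_2_eq_2] less_Suc_eq strict_mono_on_def)

lemma unshuffles_permutes: "\<sigma> \<in> unshuffles bs \<Longrightarrow> \<sigma> permutes {..<sum_list bs}"
  unfolding unshuffles_def by blast

lemma sum_unshuffles_pair:
  "(\<Sum>\<sigma>\<in>{id, Transposition.transpose 0 (1::nat)}. of_int (sign \<sigma>) *\<^sub>R g \<sigma>)
    = g id - (g (Transposition.transpose 0 1) :: 'b::real_vector)"
proof -
  \<comment> \<open>Distinctness ensures that the sum over the set really has two terms, with signs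
    1 and -1.\<close>
  have "Transposition.transpose 0 (1::nat) \<noteq> id"
    by (metis id_apply transpose_apply_first zero_neq_one)
  then show ?thesis by (simp add: sign_swap_id)
qed

lemma bundle_map_cochain_single:
  "u \<in> sections M E \<Longrightarrow> bundle_map_cochain M E T [u] = on_sections T u"
  by (simp add: bundle_map_cochain_def cochain_of_def on_sections_def)

lemma bundle_map_cochain_length: "length us \<noteq> 1 \<Longrightarrow> bundle_map_cochain M E T us = 0"
  by (simp add: bundle_map_cochain_def cochain_of_def)

lemma length_pick [simp]: "length (pick \<sigma> us a b) = b - a"
  by (simp add: pick_def)

section \<open>Consequences of the axioms of a LieRep pair\<close>

locale lierep =
  fixes M :: "'m::{t2_space, second_countable_topology} manifold"
    and A :: "('m, 'a::real_vector) algebroid"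
    and E :: "('m, 'e::real_vector) vbundle"
    and \<rho> :: "('m \<Rightarrow> 'a) \<Rightarrow> ('m \<Rightarrow> 'e) \<Rightarrow> 'm \<Rightarrow> 'e"
  assumes M: "smooth_manifold M" and pair: "lierep_pair M A E \<rho>"
begin

lemma E: "vector_bundle M E" and A: "vector_bundle M (bdl A)"
  using pair unfolding lierep_pair_def lie_algebroid_def Let_def by blast+

lemma brk_add_right:
  "x \<in> sections M (bdl A) \<Longrightarrow> y \<in> sections M (bdl A) \<Longrightarrow> z \<in> sections M (bdl A) \<Longrightarrow>
    brk A x (y + z) = brk A x y + brk A x z"
  using pair unfolding lierep_pair_def lie_algebroid_def Let_def linear_between_def by blast

lemma brk_add_left:
  "x \<in> sections M (bdl A) \<Longrightarrow> y \<in> sections M (bdl A) \<Longrightarrow> z \<in> sections M (bdl A) \<Longrightarrow>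
    brk A (x + y) z = brk A x z + brk A y z"
  using pair unfolding lierep_pair_def lie_algebroid_def Let_def linear_between_def by blast

lemma brk_self: "x \<in> sections M (bdl A) \<Longrightarrow> brk A x x = 0"
  using pair unfolding lierep_pair_def lie_algebroid_def Let_def by blast

lemma brk_0_right:
  assumes "x \<in> sections M (bdl A)"
  shows "brk A x 0 = 0"
  using brk_add_right[OF assms zero_in_sections[OF M A] zero_in_sections[OF M A]] by simp

lemma brk_0_left:
  assumes "x \<in> sections M (bdl A)"
  shows "brk A 0 x = 0"
  using brk_add_left[OF zero_in_sections[OF M A] zero_in_sections[OF M A] assms] by simp

text \<open>Polarisation: expand the vanishing bracket of \<open>x + y\<close> with itself.\<close>

lemma brk_skew:
  assumes "x \<in> sections M (bdl A)" "y \<in> sections M (bdl A)"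
  shows "brk A x y = - brk A y x"
proof -
  note xy = add_in_sections[OF M A assms]
  have "brk A (x + y) (x + y) = brk A x x + brk A x y + (brk A y x + brk A y y)"
    by (simp add: brk_add_left[OF assms xy] brk_add_right assms)
  then have "brk A x y + brk A y x = 0" by (simp add: brk_self xy assms)
  then show ?thesis by (simp add: eq_neg_iff_add_eq_0)
qed

lemma rho_in_sections:
  "x \<in> sections M (bdl A) \<Longrightarrow> u \<in> sections M E \<Longrightarrow> \<rho> x u \<in> sections M E"
  using pair unfolding lierep_pair_def representation_def Let_def linear_between_def by blast

lemma rho_add:
  "x \<in> sections M (bdl A) \<Longrightarrow> y \<in> sections M (bdl A) \<Longrightarrow> u \<in> sections M E \<Longrightarrow>
    \<rho> (x + y) u = \<rho> x u + \<rho> y u"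
  using pair unfolding lierep_pair_def representation_def Let_def by blast

lemma rho_0: "u \<in> sections M E \<Longrightarrow> \<rho> 0 u = 0"
  using rho_add[OF zero_in_sections[OF M A] zero_in_sections[OF M A]] by simp

context
  fixes S assumes S: "bundle_map M E (bdl A) S"
begin

lemma image_in_sections: "u \<in> sections M E \<Longrightarrow> on_sections S u \<in> sections M (bdl A)"
  by (rule on_sections_in_sections[OF M E A S])

text \<open>Lists of the wrong length or with entries that are not sections take the default value
  0, itself a section. Hence the rules for the bracket apply to cochain values without a case
  distinction on the arguments.\<close>

lemma cochain_in_sections: "bundle_map_cochain M E S us \<in> sections M (bdl A)"
proof (cases "length us = 1 \<and> set us \<subseteq> sections M E")
  case True
  then obtain u where "us = [u]" "u \<in> sections M E" by (auto simp: length_Suc_conv)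
  then show ?thesis by (simp add: bundle_map_cochain_single image_in_sections)
next
  case False
  then show ?thesis using zero_in_sections[OF M A]
    by (auto simp: bundle_map_cochain_def cochain_of_def)
qed

lemma on_sections_diff:
  "u \<in> sections M E \<Longrightarrow> v \<in> sections M E \<Longrightarrow> on_sections S (u - v) = on_sections S u - on_sections S v"
  unfolding on_sections_def fun_eq_iff fun_diff_def
  by (auto intro!: linear_between_diff[OF bundle_map_linear[OF S] subspace_fibre[OF E]]
      simp: sections_def)

lemma on_sections_add:
  "u \<in> sections M E \<Longrightarrow> v \<in> sections M E \<Longrightarrow> on_sections S (u + v) = on_sections S u + on_sections S v"
  using bundle_map_linear[OF S] unfolding on_sections_def fun_eq_iff plus_fun_def linear_between_def sections_def
  by blast

lemma on_sections_0: "on_sections S 0 = 0"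
  using linear_between_0[OF bundle_map_linear[OF S] subspace_fibre[OF E]]
  by (auto simp: on_sections_def fun_eq_iff)

end

section \<open>Brackets of two cochains of degree one\<close>

context
  fixes P Q assumes P: "bundle_map M E (bdl A) P" and Q: "bundle_map M E (bdl A) Q"
begin

text \<open>If \<open>n \<noteq> 1\<close>, the outer cochain receives a list of the wrong length,
  or the sum is 0 by convention. If \<open>n = 1\<close>, the inner cochain does, and its value 0 is
  carried through \<open>\<rho>\<close> and \<open>P\<close>.\<close>

lemma insertion_sum_eq_0:
  assumes "set us \<subseteq> sections M E" "length us = n + m" "n \<noteq> 1 \<or> m \<noteq> 1"
  shows "insertion_sum \<rho> n m (bundle_map_cochain M E P) (bundle_map_cochain M E Q) us = 0"
proof (cases "n = 0")
  case False
  have "bundle_map_cochain M E P (\<rho> (bundle_map_cochain M E Q (pick \<sigma> us 0 m)) (us ! \<sigma> m)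
      # pick \<sigma> us (m + 1) (m + n)) = 0" if "\<sigma> \<in> unshuffles [m, 1, n - 1]" for \<sigma>
  proof (cases "n = 1")
    case True
    \<comment> \<open>For \<open>n = 1\<close> the blocks have total length \<open>m + 1\<close>, so
      index \<open>m\<close> is permuted within the list. The entry acted on is then a genuine
      section, as \<open>rho_0\<close> requires.\<close>
    have "\<sigma> m < length us"
      using permutes_in_image[OF unshuffles_permutes[OF that], of m] assms(2) True by simp
    then have "us ! \<sigma> m \<in> sections M E" using assms(1) by auto
    moreover have "bundle_map_cochain M E Q (pick \<sigma> us 0 m) = 0"
      using assms(3) True by (intro bundle_map_cochain_length) simp
    ultimately show ?thesis using True
      by (simp add: rho_0 pick_def bundle_map_cochain_single zero_in_sections[OF M E] on_sections_0[OF P])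
  qed (use False in \<open>auto intro!: bundle_map_cochain_length\<close>)
  then show ?thesis unfolding insertion_sum_def by simp
qed (simp add: insertion_sum_def)

lemma insertion_sum_1_1:
  assumes "u \<in> sections M E" "v \<in> sections M E"
  shows "insertion_sum \<rho> 1 1 (bundle_map_cochain M E P) (bundle_map_cochain M E Q) [u, v] =
    on_sections P (\<rho> (on_sections Q u) v) - on_sections P (\<rho> (on_sections Q v) u)"
  unfolding insertion_sum_def using assms
  by (simp add: unshuffles_1_1_0[simplified] sum_unshuffles_pair[simplified] pick_def
      bundle_map_cochain_single rho_in_sections image_in_sections[OF Q])

end

context
  fixes P Q assumes P: "bundle_map M E (bdl A) P" and Q: "bundle_map M E (bdl A) Q"
begin

text \<open>In every term at least one cochain is evaluated outside degree 1. The bracket contains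
  insertions in both orders, so the fresh context lets the preceding lemmas be applied to
  \<open>P\<close>, \<open>Q\<close> and to \<open>Q\<close>, \<open>P\<close>.\<close>

lemma hom_bracket_eq_0:
  assumes "set us \<subseteq> sections M E" "length us = n + m" "n \<noteq> 1 \<or> m \<noteq> 1"
  shows "hom_bracket A \<rho> n m (bundle_map_cochain M E P) (bundle_map_cochain M E Q) us = 0"
proof -
  have "brk A (bundle_map_cochain M E P (pick \<sigma> us 0 n))
      (bundle_map_cochain M E Q (pick \<sigma> us n (m + n))) = 0" for \<sigma>
  proof (cases "n = 1")
    case True
    then have "bundle_map_cochain M E Q (pick \<sigma> us n (m + n)) = 0"
      using assms(3) by (intro bundle_map_cochain_length) simp
    then show ?thesis by (simp only: brk_0_right cochain_in_sections[OF P])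
  qed (simp add: bundle_map_cochain_length[of "pick \<sigma> us 0 n"] brk_0_left cochain_in_sections[OF Q])
  moreover have "insertion_sum \<rho> n m (bundle_map_cochain M E P) (bundle_map_cochain M E Q) us = 0"
    by (rule insertion_sum_eq_0[OF P Q assms])
  moreover have "insertion_sum \<rho> m n (bundle_map_cochain M E Q) (bundle_map_cochain M E P) us = 0"
    by (rule insertion_sum_eq_0[OF Q P assms(1)]) (use assms in auto)
  ultimately show ?thesis unfolding hom_bracket_def by simp
qed

text \<open>A length other than 2 cannot split as 1 + 1, so all degree components vanish; lists with
  entries that are not sections give 0 by convention. Thus an equation between such brackets need
  only be tested on pairs of sections.\<close>

lemma graded_bracket_eq_0:
  assumes "\<not> (length us = 2 \<and> set us \<subseteq> sections M E)"
  shows "graded_bracket M A E \<rho> (bundle_map_cochain M E P) (bundle_map_cochain M E Q) us = 0"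
proof (cases "set us \<subseteq> sections M E")
  case True
  have "hom_bracket A \<rho> n (length us - n) (bundle_map_cochain M E P) (bundle_map_cochain M E Q) us = 0"
    if "n \<le> length us" for n
    using that True assms by (intro hom_bracket_eq_0) auto
  then show ?thesis unfolding graded_bracket_def by simp
qed (simp add: graded_bracket_def)

lemma graded_bracket_pair:
  assumes "u \<in> sections M E" "v \<in> sections M E"
  shows "graded_bracket M A E \<rho> (bundle_map_cochain M E P) (bundle_map_cochain M E Q) [u, v] =
    on_sections P (\<rho> (on_sections Q u) v) - on_sections P (\<rho> (on_sections Q v) u)
    + (on_sections Q (\<rho> (on_sections P u) v) - on_sections Q (\<rho> (on_sections P v) u))
    - (brk A (on_sections P u) (on_sections Q v) - brk A (on_sections P v) (on_sections Q u))"
proof -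
  let ?P = "bundle_map_cochain M E P" and ?Q = "bundle_map_cochain M E Q"
  have "{..length [u, v]} = {0, 1, 2}" by auto
  then have "graded_bracket M A E \<rho> ?P ?Q [u, v] =
      hom_bracket A \<rho> 0 2 ?P ?Q [u, v] + hom_bracket A \<rho> 1 1 ?P ?Q [u, v] + hom_bracket A \<rho> 2 0 ?P ?Q [u, v]"
    unfolding graded_bracket_def using assms by (simp add: numeral_2_eq_2 add.assoc)
  also have "\<dots> = hom_bracket A \<rho> 1 1 ?P ?Q [u, v]"
    using assms by (simp add: hom_bracket_eq_0)
  \<comment> \<open>An auxiliary evaluation of the Lie bracket sum, fed into the next equation,
    which is the actual link in the chain.\<close>
  also have "(\<Sum>\<sigma>\<in>unshuffles [1, 1]. of_int (sign \<sigma>) *\<^sub>R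
        brk A (?P (pick \<sigma> [u, v] 0 1)) (?Q (pick \<sigma> [u, v] 1 (1 + 1)))) =
      brk A (on_sections P u) (on_sections Q v) - brk A (on_sections P v) (on_sections Q u)"
    unfolding unshuffles_1_1 sum_unshuffles_pair
    using assms by (simp add: pick_def bundle_map_cochain_single)
  \<comment> \<open>Here \<open>(-1) ^ (m * n)\<close> is -1: the second insertion sum acquires a
    plus sign and the Lie bracket sum a minus sign.\<close>
  then have "hom_bracket A \<rho> 1 1 ?P ?Q [u, v] =
      insertion_sum \<rho> 1 1 ?P ?Q [u, v] + insertion_sum \<rho> 1 1 ?Q ?P [u, v]
      - (brk A (on_sections P u) (on_sections Q v) - brk A (on_sections P v) (on_sections Q u))"
    unfolding hom_bracket_def by simp
  finally show ?thesis
    unfolding insertion_sum_1_1[OF P Q assms] insertion_sum_1_1[OF Q P assms] .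
qed

end

section \<open>The Maurer--Cartan equation on pairs of sections\<close>

lemma maurer_cartan_iff:
  assumes P: "bundle_map M E (bdl A) P" and Q: "bundle_map M E (bdl A) Q"
  shows "maurer_cartan (rota_baxter_dgla M A E \<rho> P) (bundle_map_cochain M E Q) \<longleftrightarrow>
    (\<forall>u\<in>sections M E. \<forall>v\<in>sections M E.
      brk A (on_sections P u) (on_sections Q v) + brk A (on_sections Q u) (on_sections P v)
        + brk A (on_sections Q u) (on_sections Q v) =
      on_sections P (\<rho> (on_sections Q u) v) - on_sections P (\<rho> (on_sections Q v) u)
        + (on_sections Q (\<rho> (on_sections P u) v) - on_sections Q (\<rho> (on_sections P v) u))
        + (on_sections Q (\<rho> (on_sections Q u) v) - on_sections Q (\<rho> (on_sections Q v) u)))"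
    (is "_ \<longleftrightarrow> (\<forall>u\<in>_. \<forall>v\<in>_. ?lhs u v = ?rhs u v)")
proof -
  let ?P = "bundle_map_cochain M E P" and ?Q = "bundle_map_cochain M E Q"
  let ?mc = "\<lambda>us. graded_bracket M A E \<rho> ?P ?Q us + (1 / 2) *\<^sub>R graded_bracket M A E \<rho> ?Q ?Q us"
  have skew: "brk A (on_sections S u) (on_sections S' v) = - brk A (on_sections S' v) (on_sections S u)"
    if "bundle_map M E (bdl A) S" "bundle_map M E (bdl A) S'" "u \<in> sections M E" "v \<in> sections M E"
    for S S' u v
    by (intro brk_skew image_in_sections that)
  \<comment> \<open>Skew-symmetry turns the bracket difference for \<open>P\<close>,
    \<open>Q\<close> into the two mixed terms of \<open>?lhs\<close>. For \<open>Q\<close>,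
    \<open>Q\<close> it doubles the single bracket, and the insertion terms double as well, so the
    factor 1/2 cancels.\<close>
  have *: "?mc [u, v] = ?rhs u v - ?lhs u v" if "u \<in> sections M E" "v \<in> sections M E" for u v
  proof -
    have "graded_bracket M A E \<rho> ?Q ?Q [u, v] = 2 *\<^sub>R (on_sections Q (\<rho> (on_sections Q u) v)
        - on_sections Q (\<rho> (on_sections Q v) u) - brk A (on_sections Q u) (on_sections Q v))"
      unfolding graded_bracket_pair[OF Q Q that] skew[OF Q Q that(2,1)] by (simp add: scaleR_2)
    then show ?thesis
      unfolding graded_bracket_pair[OF P Q that] skew[OF P Q that(2,1)] by simp
  qed
  have "maurer_cartan (rota_baxter_dgla M A E \<rho> P) ?Q \<longleftrightarrow> (\<forall>us. ?mc us = 0)"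
    using bundle_map_cochain_in_cochains[OF M E A Q]
    by (simp add: maurer_cartan_def rota_baxter_dgla_def fun_eq_iff scaleR_fun_def)
  \<comment> \<open>Both brackets have degree 2, hence vanish on every other list.\<close>
  also have "\<dots> \<longleftrightarrow> (\<forall>u\<in>sections M E. \<forall>v\<in>sections M E. ?mc [u, v] = 0)"
  proof (intro iffI allI ballI)
    fix us assume pairs: "\<forall>u\<in>sections M E. \<forall>v\<in>sections M E. ?mc [u, v] = 0"
    show "?mc us = 0"
    proof (cases "length us = 2 \<and> set us \<subseteq> sections M E")
      case True
      then obtain u v where "us = [u, v]" "u \<in> sections M E" "v \<in> sections M E"
        by (auto simp: numeral_2_eq_2 length_Suc_conv)
      then show ?thesis using pairs by blast
    qed (simp add: graded_bracket_eq_0[OF P Q] graded_bracket_eq_0[OF Q Q])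
  qed blast
  also have "\<dots> \<longleftrightarrow> (\<forall>u\<in>sections M E. \<forall>v\<in>sections M E. ?lhs u v = ?rhs u v)"
    using * by (intro ball_cong refl) (metis eq_iff_diff_eq_0)
  finally show ?thesis .
qed

text \<open>Both sides of the Rota--Baxter equation for \<open>P + Q\<close> are expanded. The terms
  in \<open>P\<close> alone agree by hypothesis and cancel, leaving the equation of
  \<open>maurer_cartan_iff\<close>.\<close>

lemma rota_baxter_add_iff:
  assumes P: "relative_rota_baxter M A E \<rho> P" and Q: "bundle_map M E (bdl A) Q"
  shows "relative_rota_baxter M A E \<rho> (P + Q) \<longleftrightarrow>
    maurer_cartan (rota_baxter_dgla M A E \<rho> P) (bundle_map_cochain M E Q)"
proof -
  have P': "bundle_map M E (bdl A) P" using P unfolding relative_rota_baxter_def by blast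
  note PQ = bundle_map_add[OF M E A P' Q]
  have plus: "on_sections (P + Q) u = on_sections P u + on_sections Q u" for u
    by (auto simp: on_sections_def)
  have "brk A (on_sections (P + Q) u) (on_sections (P + Q) v) =
        on_sections (P + Q) (\<rho> (on_sections (P + Q) u) v - \<rho> (on_sections (P + Q) v) u) \<longleftrightarrow>
      brk A (on_sections P u) (on_sections Q v) + brk A (on_sections Q u) (on_sections P v)
        + brk A (on_sections Q u) (on_sections Q v) =
      on_sections P (\<rho> (on_sections Q u) v) - on_sections P (\<rho> (on_sections Q v) u)
        + (on_sections Q (\<rho> (on_sections P u) v) - on_sections Q (\<rho> (on_sections P v) u))
        + (on_sections Q (\<rho> (on_sections Q u) v) - on_sections Q (\<rho> (on_sections Q v) u))"
    (is "?l = ?r \<longleftrightarrow> ?l' = ?r'")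
    if u: "u \<in> sections M E" and v: "v \<in> sections M E" for u v
  proof -
    note im = image_in_sections[OF P'] image_in_sections[OF Q]
    have l: "?l = brk A (on_sections P u) (on_sections P v) + ?l'"
      unfolding plus using u v
      by (simp add: brk_add_left brk_add_right im add_in_sections[OF M A] algebra_simps)
    have "?r = on_sections (P + Q) (\<rho> (on_sections (P + Q) u) v)
        - on_sections (P + Q) (\<rho> (on_sections (P + Q) v) u)"
      by (intro on_sections_diff[OF PQ] rho_in_sections image_in_sections[OF PQ] u v)
    also have "\<dots> = on_sections P (\<rho> (on_sections P u) v) - on_sections P (\<rho> (on_sections P v) u) + ?r'"
      unfolding plus using u v
      by (simp add: rho_add on_sections_add[OF P'] on_sections_add[OF Q] rho_in_sections im algebra_simps)
    \<comment> \<open>The pure \<open>P\<close> terms are gathered under one application of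
      \<open>P\<close>, the form in which the Rota--Baxter identity for \<open>P\<close> replaces
      them by a Lie bracket.\<close>
    also have "on_sections P (\<rho> (on_sections P u) v) - on_sections P (\<rho> (on_sections P v) u)
        = on_sections P (\<rho> (on_sections P u) v - \<rho> (on_sections P v) u)"
      by (intro on_sections_diff[OF P', symmetric] rho_in_sections im u v)
    also have "\<dots> = brk A (on_sections P u) (on_sections P v)"
      using P u v unfolding relative_rota_baxter_def by simp
    finally show ?thesis unfolding l by (simp only: add_left_cancel)
  qed
  then show ?thesis
    unfolding maurer_cartan_iff[OF P' Q] using PQ by (simp add: relative_rota_baxter_def)
qed

end

theorem theorem2p6:
  fixes M :: "'m::{t2_space, second_countable_topology} manifold"
    and A :: "('m, 'a::real_vector) algebroid"
    and E :: "('m, 'e::real_vector) vbundle"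
    and \<rho> :: "('m \<Rightarrow> 'a) \<Rightarrow> ('m \<Rightarrow> 'e) \<Rightarrow> 'm \<Rightarrow> 'e"
    and T T' :: "'m \<Rightarrow> 'e \<Rightarrow> 'a"
  assumes "smooth_manifold M"
    and "lierep_pair M A E \<rho>"
    and "relative_rota_baxter M A E \<rho> T"
    and "bundle_map M E (bdl A) T'"
  shows "relative_rota_baxter M A E \<rho> (T + T') \<longleftrightarrow>
    maurer_cartan (rota_baxter_dgla M A E \<rho> T) (bundle_map_cochain M E T')"
proof -
  interpret lierep M A E \<rho> using assms(1,2) by unfold_locales
  show ?thesis by (rule rota_baxter_add_iff[OF assms(3,4)])
qed

end
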